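(* Let $n\ge 2$ be an integer, $\sigma\in(0,1]$, $A\in\mathcal{A}_\sigma$, and $f(x)=\frac12x^\top Ax$ on $\mathbb{R}^n$. For an initial point $x_0\in\mathbb{R}^n$, let $x_T$ be the output of random coordinate descent (RCD) applied to $f$ after $T$ iterations. Then, for all $x_0$ outside a Lebesgue measure zero set of initial points, $$\lim_{T\to\infty}\left(\frac{\mathbb{E}\left[\|x_T\|^2\right]}{\|x_0\|^2}\right)^{1/T} \ge 1-\frac1n+\frac{(1-\sigma)^2}{n}.$$
   Context: Function class: for $\sigma\in(0,1]$, $\mathcal{A}_\sigma^{\mathrm{PI}}$ is the set of $n\times n$ block-diagonal matrices $\mathrm{diag}\{\sigma I_k + (1-\sigma)\mathbf{1}_k\mathbf{1}_k^\top,\ I_{n-k}\}$ with $2\le k\le n$ an integer, where $I_k$ is the $k\times k$ identity and $\mathbf{1}_k$ the all-ones vector in $\mathbb{R}^k$. Then $\mathcal{A}_\sigma = \{A^{\mathrm{PI}}\odot vv^\top : A^{\mathrm{PI}}\in\mathcal{A}_\sigma^{\mathrm{PI}},\ v\in\{\pm1\}^n\}$, where $\odot$ is the entrywise (Hadamard) product. All matrices in $\mathcal{A}_\sigma$ are symmetric positive definite with unit diagonal. Random coordinate descent (RCD) on $f(x)=\frac12 x^\top A x$, started at a deterministic $x_0\in\mathbb{R}^n$: at each iteration $t=0,1,2,\dots$, an index $i_t$ is drawn uniformly at random from $\{1,\dots,n\}$, independently across iterations, and the coordinate $i_t$ of $x_t$ is replaced by the exact minimizer of $f$ over that coordinate,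 all other coordinates being kept fixed. Since $A$ has unit diagonal, this is $x_{t+1} = (I - E_{i_t}A)x_t$, where $E_i = e_i e_i^\top$ and $e_i$ is the $i$-th standard basis vector. $\|\cdot\|$ is the Euclidean norm and the expectation is over the random indices, conditional on $x_0$. *)

theory Defs
  imports "HOL-Probability.Probability"
begin

text \<open>
  Vectors in \<open>\<real>\<^sup>n\<close> have type \<^typ>\<open>real ^ 'n\<close> with \<open>n = CARD('n)\<close>.  The index type is linearly
  ordered, which makes ``the leading \<open>k \<times> k\<close> block'' meaningful: \<open>position i\<close> is the 1-based
  position of the index \<open>i\<close>.
\<close>

definition position :: "'n::{finite,linorder} \<Rightarrow> nat" where
  "position i = card {..i}"

definition PI_matrix :: "real \<Rightarrow> nat \<Rightarrow> real ^ 'n::{finite,linorder} ^ 'n::{finite,linorder}" where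
  "PI_matrix \<sigma> k = (\<chi> i j.
     if position i \<le> k \<and> position j \<le> k
     then \<sigma> * (if i = j then 1 else 0) + (1 - \<sigma>)
     else (if i = j then 1 else 0))"

definition PI_class :: "real \<Rightarrow> (real ^ 'n::{finite,linorder} ^ 'n::{finite,linorder}) set" where
  "PI_class \<sigma> = {PI_matrix \<sigma> k | k. 2 \<le> k \<and> k \<le> CARD('n)}"

definition hadamard :: "real ^ 'n ^ 'm \<Rightarrow> real ^ 'n ^ 'm \<Rightarrow> real ^ 'n ^ 'm" where
  "hadamard A B = (\<chi> i j. A $ i $ j * B $ i $ j)"

definition outer_prod :: "real ^ 'm \<Rightarrow> real ^ 'n \<Rightarrow> real ^ 'n ^ 'm" where
  "outer_prod u v = (\<chi> i j. u $ i * v $ j)"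

definition A_class :: "real \<Rightarrow> (real ^ 'n::{finite,linorder} ^ 'n::{finite,linorder}) set" where
  "A_class \<sigma> = {hadamard P (outer_prod v v) | P v.
     P \<in> PI_class \<sigma> \<and> (\<forall>i. v $ i \<in> {-1, 1})}"

definition quadratic :: "real ^ 'n ^ 'n \<Rightarrow> real ^ 'n \<Rightarrow> real" where
  "quadratic A x = 1 / 2 * (x \<bullet> (A *v x))"

definition set_coord :: "real ^ 'n \<Rightarrow> 'n \<Rightarrow> real \<Rightarrow> real ^ 'n" where
  "set_coord x i s = (\<chi> j. if j = i then s else x $ j)"

text \<open>
  \<open>arg_min\<close> picks an arbitrary value if there is no minimizer; for the quadratics considered here
  the minimizer exists and is unique (see \<open>cd_step_quadratic\<close> below).
\<close>

definition cd_step :: "(real ^ 'n \<Rightarrow> real) \<Rightarrow> 'n \<Rightarrow> real ^ 'n \<Rightarrow> real ^ 'n" where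
  "cd_step f i x = set_coord x i (arg_min (\<lambda>s. f (set_coord x i s)) (\<lambda>_. True))"

primrec cd_iterate ::
  "(real ^ 'n \<Rightarrow> real) \<Rightarrow> (nat \<Rightarrow> 'n) \<Rightarrow> real ^ 'n \<Rightarrow> nat \<Rightarrow> real ^ 'n" where
  "cd_iterate f \<iota> x\<^sub>0 0 = x\<^sub>0"
| "cd_iterate f \<iota> x\<^sub>0 (Suc t) = cd_step f (\<iota> t) (cd_iterate f \<iota> x\<^sub>0 t)"

definition iid_uniform_indices :: "'w measure \<Rightarrow> (nat \<Rightarrow> 'w \<Rightarrow> 'n::finite) \<Rightarrow> bool" where
  "iid_uniform_indices M \<iota> \<longleftrightarrow>
     prob_space M \<and>
     prob_space.indep_vars M (\<lambda>_. count_space UNIV) \<iota> UNIV \<and>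
     (\<forall>t. distr M (count_space UNIV) (\<iota> t) = uniform_count_measure UNIV)"

lemma set_coord_axis: "set_coord x i s = x + (s - x $ i) *\<^sub>R axis i 1"
  by (auto simp: set_coord_def vec_eq_iff axis_def)

lemma quadratic_set_coord:
  fixes A :: "real ^ 'n ^ 'n"
  assumes sym: "transpose A = A" and diag: "A $ i $ i = 1"
  shows "quadratic A (set_coord x i s) =
    quadratic A (x - ((A *v x) $ i) *\<^sub>R axis i 1) + 1 / 2 * (s - (x $ i - (A *v x) $ i))\<^sup>2"
proof -
  have 1: "quadratic A (x + c *\<^sub>R axis i 1) = quadratic A x + c * (A *v x) $ i + c\<^sup>2 / 2" for c
  proof -
    have a: "axis i 1 \<bullet> y = y $ i" for y :: "real ^ 'n"
      by (simp add: inner_axis')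
    have b: "x \<bullet> (A *v axis i 1) = (A *v x) $ i"
    proof -
      have "x v* A = A *v x"
        using transpose_matrix_vector[of A x] sym by simp
      then show ?thesis
        using dot_lmul_matrix[of x A "axis i 1"] by (simp add: inner_axis)
    qed
    have "(A *v axis i 1) $ i = 1"
      using diag by (simp add: matrix_vector_mult_basis column_def)
    with a[of "A *v x"] a[of "A *v axis i 1"] b show ?thesis
      by (simp add: quadratic_def matrix_vector_right_distrib matrix_vector_mult_scaleR
          inner_add_left inner_add_right algebra_simps power2_eq_square)
  qed
  show ?thesis
    using 1[of "s - x $ i"] 1[of "- (A *v x) $ i"]
    by (simp add: set_coord_axis power2_eq_square field_simps)
qed

lemma cd_step_quadratic:
  fixes A :: "real ^ 'n ^ 'n"
  assumes "transpose A = A" "A $ i $ i = 1"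
  shows "cd_step (quadratic A) i x = (mat 1 - outer_prod (axis i 1) (axis i 1) ** A) *v x"
proof -
  have "arg_min (\<lambda>s. quadratic A (set_coord x i s)) (\<lambda>_. True) = x $ i - (A *v x) $ i"
    (is "?m = ?s")
  proof -
    have "is_arg_min (\<lambda>s. quadratic A (set_coord x i s)) (\<lambda>_. True) ?s"
      unfolding is_arg_min_linorder quadratic_set_coord[OF assms] by simp
    then have "is_arg_min (\<lambda>s. quadratic A (set_coord x i s)) (\<lambda>_. True) ?m"
      unfolding arg_min_def by (rule someI)
    then have "quadratic A (set_coord x i ?m) \<le> quadratic A (set_coord x i ?s)"
      unfolding is_arg_min_linorder by blast
    then have "1 / 2 * (?m - ?s)\<^sup>2 \<le> 1 / 2 * (?s - ?s)\<^sup>2"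
      unfolding quadratic_set_coord[OF assms] by (simp only: add_le_cancel_left)
    then show ?thesis by simp
  qed
  moreover have "(outer_prod (axis i 1) (axis i 1) ** A) *v x = ((A *v x) $ i) *\<^sub>R axis i 1"
  proof -
    have "outer_prod (axis i 1) (axis i 1) *v y = (y $ i) *\<^sub>R axis i 1" for y :: "real ^ 'n"
    proof -
      have "(\<Sum>j\<in>UNIV. axis i 1 $ k * axis i 1 $ j * y $ j) = axis i 1 $ k * y $ i" for k
      proof -
        have "(\<Sum>j\<in>UNIV. axis i 1 $ k * axis i 1 $ j * y $ j) =
          (\<Sum>j\<in>UNIV. if j = i then axis i 1 $ k * y $ j else 0)"
          by (rule sum.cong) (auto simp: axis_def)
        then show ?thesis by simp
      qed
      then show ?thesis
        by (simp add: vec_eq_iff outer_prod_def matrix_vector_mult_def mult.commute)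
    qed
    then show ?thesis by (simp add: matrix_vector_mul_assoc[symmetric])
  qed
  ultimately show ?thesis
    by (simp add: cd_step_def set_coord_axis matrix_vector_mult_diff_rdistrib)
qed

lemma A_class_symmetric:
  fixes A :: "real ^ 'n::{finite,linorder} ^ 'n::{finite,linorder}"
  shows "A \<in> A_class \<sigma> \<Longrightarrow> transpose A = A"
proof -
  assume "A \<in> A_class \<sigma>"
  then obtain k v where A: "A = hadamard (PI_matrix \<sigma> k) (outer_prod v v)"
    unfolding A_class_def PI_class_def by blast
  have "PI_matrix \<sigma> k $ i $ j = PI_matrix \<sigma> k $ j $ i" for i j :: 'n
    by (simp add: PI_matrix_def conj_commute eq_commute)
  then show ?thesis
    by (simp add: A transpose_def vec_eq_iff hadamard_def outer_prod_def mult.commute)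
qed

lemma A_class_unit_diagonal: "A \<in> A_class \<sigma> \<Longrightarrow> A $ i $ i = 1"
proof -
  assume "A \<in> A_class \<sigma>"
  then obtain k v where "A = hadamard (PI_matrix \<sigma> k) (outer_prod v v)" "v $ i \<in> {-1, 1}"
    by (auto simp: A_class_def PI_class_def)
  then show ?thesis
    by (auto simp: hadamard_def outer_prod_def PI_matrix_def)
qed

end

theory Submission
  imports Defs "HOL-Real_Asymp.Real_Asymp"
begin

text \<open>
  Up to the signs \<open>v\<close>, a coordinate step only changes the three quantities
  \<open>p = \<Sum>\<^sub>B x\<^sub>i\<^sup>2\<close>, \<open>s = (\<Sum>\<^sub>B v\<^sub>i x\<^sub>i)\<^sup>2\<close> and \<open>q = \<Sum>\<^sub>-\<^sub>B x\<^sub>i\<^sup>2\<close>, where \<open>B\<close> is the set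
  of the first \<open>k\<close> indices, and in expectation it acts linearly on them: \<open>q\<close> is multiplied by
  \<open>1 - 1/n\<close>, and \<open>(p, s)\<close> by a nonnegative \<open>2 \<times> 2\<close> matrix.  A left eigenvector \<open>(1, u)\<close> of
  that matrix with \<open>u \<ge> 0\<close> has an eigenvalue \<open>\<rho>\<close> that is at least the diagonal entry
  \<open>1 - 1/n + (1 - \<sigma>)\<^sup>2/n\<close>.  Since \<open>s \<le> k p\<close>, the expectation of \<open>p + q = \<parallel>x\<^sub>T\<parallel>\<^sup>2\<close> is squeezed
  between two positive multiples of \<open>\<rho>\<^sup>T\<close> unless \<open>x\<^sub>0\<close> vanishes on \<open>B\<close>.
\<close>

section \<open>Limits of roots under geometric bounds\<close>

text \<open>Constant factors disappear because \<open>d powr (1 / real T)\<close> tends to 1 for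
  every \<open>d > 0\<close>. Having the same rate \<open>c\<close> on both sides makes the limit
  exist; a lower bound alone would control only the liminf.\<close>

lemma powr_inverse_tendsto_of_geometric_bounds:
  fixes f :: "nat \<Rightarrow> real"
  assumes "0 < a" "0 < c"
    and lower: "\<And>T. a * c ^ T \<le> f T" and upper: "\<And>T. f T \<le> b * c ^ T"
  shows "(\<lambda>T. f T powr (1 / real T)) \<longlonglongrightarrow> c"
proof (rule tendsto_sandwich)
  have "0 < b"
    using lower[of 0] upper[of 0] \<open>0 < a\<close> by simp
  \<comment> \<open>At \<open>T = 0\<close> the exponent \<open>1 / real T\<close> is 0 and this
    identity can fail, so the comparisons below are only made eventually.\<close>
  have eq: "(d * c ^ T) powr (1 / real T) = d powr (1 / real T) * c"
    if "0 < d" "0 < T" for d T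
    using that \<open>0 < c\<close>
    by (simp add: powr_mult powr_powr flip: powr_realpow)
  have "(\<lambda>T. d powr (1 / real T) * c) \<longlonglongrightarrow> c" if "0 < d" for d
    using that by real_asymp
  then show "(\<lambda>T. a powr (1 / real T) * c) \<longlonglongrightarrow> c" "(\<lambda>T. b powr (1 / real T) * c) \<longlonglongrightarrow> c"
    using \<open>0 < a\<close> \<open>0 < b\<close> by blast+
  show "\<forall>\<^sub>F T in sequentially. a powr (1 / real T) * c \<le> f T powr (1 / real T)"
    using eventually_gt_at_top[of 0]
  proof eventually_elim
    case (elim T)
    show ?case
      unfolding eq[OF \<open>0 < a\<close> elim, symmetric]
      using \<open>0 < a\<close> \<open>0 < c\<close> lower by (intro powr_mono2) auto
  qed
  show "\<forall>\<^sub>F T in sequentially. f T powr (1 / real T) \<le> b powr (1 / real T) * c"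
    using eventually_gt_at_top[of 0]
  proof eventually_elim
    case (elim T)
    have "0 \<le> f T"
      using lower[of T] \<open>0 < a\<close> \<open>0 < c\<close> by (meson less_eq_real_def mult_pos_pos order_trans zero_less_power)
    then show ?case
      unfolding eq[OF \<open>0 < b\<close> elim, symmetric]
      using upper by (intro powr_mono2) auto
  qed
qed

section \<open>Expectations along coordinate descent with random indices\<close>

text \<open>The iterate at time \<open>T\<close> only looks at indices before \<open>T\<close>. It
  therefore factors through a finite index tuple and is independent of the index drawn at time
  \<open>T\<close>.\<close>

lemma cd_iterate_cong:
  "(\<And>t. t < T \<Longrightarrow> \<iota> t = \<kappa> t) \<Longrightarrow> cd_iterate f \<iota> x T = cd_iterate f \<kappa> x T"
  by (induction T) auto

lemma iid_uniform_indices_measurable: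
  assumes "iid_uniform_indices M \<iota>"
  shows "(\<lambda>\<omega>. restrict (\<lambda>t. \<iota> t \<omega>) I) \<in> M \<rightarrow>\<^sub>M PiM I (\<lambda>_. count_space UNIV)"
proof -
  interpret prob_space M
    using assms by (simp add: iid_uniform_indices_def)
  have "indep_vars (\<lambda>_. count_space UNIV) \<iota> UNIV"
    using assms by (simp add: iid_uniform_indices_def)
  then have "\<And>t. \<iota> t \<in> M \<rightarrow>\<^sub>M count_space UNIV"
    by (simp add: indep_vars_def)
  then show ?thesis
    by (intro measurable_restrict)
qed

text \<open>A finite product of finite discrete spaces is again discrete.\<close>

lemma PiM_count_space_borel_measurable:
  fixes h :: "(nat \<Rightarrow> 'n::finite) \<Rightarrow> real"
  assumes "finite I"
  shows "h \<in> borel_measurable (PiM I (\<lambda>_. count_space (UNIV :: 'n set)))"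
  using assms by (subst count_space_PiM_finite) auto

text \<open>There are finitely many index tuples of length \<open>T\<close>, so the variable takes
  finitely many values and is bounded. Hence \<open>f\<close> and \<open>g\<close> can be
  arbitrary.\<close>

lemma integrable_cd_iterate:
  fixes \<iota> :: "nat \<Rightarrow> 'w \<Rightarrow> 'n::finite" and g :: "real ^ 'n \<Rightarrow> real"
  assumes iid: "iid_uniform_indices M \<iota>"
  shows "integrable M (\<lambda>\<omega>. g (cd_iterate f (\<lambda>t. \<iota> t \<omega>) x T))"
proof -
  interpret prob_space M
    using iid by (simp add: iid_uniform_indices_def)
  let ?h = "\<lambda>\<kappa>. g (cd_iterate f \<kappa> x T)"
  let ?R = "\<lambda>\<omega>. restrict (\<lambda>t. \<iota> t \<omega>) {..<T}"
  let ?E = "{..<T} \<rightarrow>\<^sub>E (UNIV :: 'n set)"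
  have eq: "g (cd_iterate f (\<lambda>t. \<iota> t \<omega>) x T) = ?h (?R \<omega>)" for \<omega>
    by (rule arg_cong[of _ _ g], rule cd_iterate_cong) simp
  have fin: "finite (?h ` ?E)"
    by (intro finite_imageI finite_PiE) auto
  then obtain C where C: "\<And>y. y \<in> ?h ` ?E \<Longrightarrow> norm y \<le> C"
    using finite_imp_bounded bounded_iff by metis
  have "?R \<omega> \<in> ?E" for \<omega>
    by (auto simp: PiE_def extensional_def)
  then have "norm (?h (?R \<omega>)) \<le> C" for \<omega>
    using C by blast
  moreover have "(\<lambda>\<omega>. ?h (?R \<omega>)) \<in> borel_measurable M"
    by (rule measurable_compose[OF iid_uniform_indices_measurable[OF iid]
          PiM_count_space_borel_measurable]) simp
  ultimately show ?thesis
    unfolding eq by (intro integrable_const_bound[of _ C]) auto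
qed

text \<open>This is the tower rule without conditional expectations: the next value is split by
  indicators of the drawn index, and each indicator is independent of the current iterate.\<close>

lemma expectation_cd_iterate_Suc:
  fixes \<iota> :: "nat \<Rightarrow> 'w \<Rightarrow> 'n::finite" and g :: "real ^ 'n \<Rightarrow> real"
  assumes iid: "iid_uniform_indices M \<iota>"
  shows "(\<integral>\<omega>. g (cd_iterate f (\<lambda>t. \<iota> t \<omega>) x (Suc T)) \<partial>M) =
    (\<integral>\<omega>. (\<Sum>i\<in>UNIV. g (cd_step f i (cd_iterate f (\<lambda>t. \<iota> t \<omega>) x T))) \<partial>M) / real CARD('n)"
proof -
  interpret prob_space M
    using iid by (simp add: iid_uniform_indices_def)
  have indep: "indep_vars (\<lambda>_. count_space UNIV) \<iota> UNIV"
    and unif: "distr M (count_space UNIV) (\<iota> T) = uniform_count_measure UNIV"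
    using iid by (simp_all add: iid_uniform_indices_def)
  have meas: "\<iota> T \<in> M \<rightarrow>\<^sub>M count_space UNIV"
    using indep by (simp add: indep_vars_def)
  let ?X = "\<lambda>\<omega>. cd_iterate f (\<lambda>t. \<iota> t \<omega>) x T"
  let ?R = "\<lambda>I \<omega>. restrict (\<lambda>t. \<iota> t \<omega>) I"
  have integrable: "integrable M (\<lambda>\<omega>. g (cd_step f i (?X \<omega>)))" for i
    by (rule integrable_cd_iterate[OF iid, of "\<lambda>y. g (cd_step f i y)"])
  have ind: "(indicator {i} (\<iota> T \<omega>) :: real) = indicator (\<iota> T -` {i} \<inter> space M) \<omega>"
    if "\<omega> \<in> space M" for i \<omega>
    using that by (auto simp: indicator_def)
  have ev: "\<iota> T -` {i} \<inter> space M \<in> events" for i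
    using meas by measurable
  have prob: "(\<integral>\<omega>. (indicator {i} (\<iota> T \<omega>) :: real) \<partial>M) = 1 / real CARD('n)" for i
  proof -
    have "(\<integral>\<omega>. (indicator {i} (\<iota> T \<omega>) :: real) \<partial>M) = (\<integral>\<omega>. indicator (\<iota> T -` {i} \<inter> space M) \<omega> \<partial>M)"
      by (intro Bochner_Integration.integral_cong ind) auto
    also have "\<dots> = prob (\<iota> T -` {i} \<inter> space M)"
      using ev by simp
    also have "\<dots> = measure (distr M (count_space UNIV) (\<iota> T)) {i}"
      using meas by (simp add: measure_distr)
    also have "\<dots> = 1 / real CARD('n)"
      unfolding unif by (subst measure_uniform_count_measure) auto
    finally show ?thesis .
  qed
  have integrable_ind: "integrable M (\<lambda>\<omega>. indicator {i} (\<iota> T \<omega>) :: real)" for i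
    using ev[of i] by (subst Bochner_Integration.integrable_cong[OF refl ind])
      (auto simp: emeasure_eq_measure intro!: integrable_real_indicator)
  \<comment> \<open>The two factors depend on the index tuples over the disjoint sets
    \<open>{T}\<close> and \<open>{..<T}\<close>.\<close>
  have step: "indep_var borel (\<lambda>\<omega>. indicator {i} (\<iota> T \<omega>) :: real)
      borel (\<lambda>\<omega>. g (cd_step f i (?X \<omega>)))" for i
  proof -
    have 1: "indep_var (PiM {T} (\<lambda>_. count_space UNIV)) (?R {T})
        (PiM {..<T} (\<lambda>_. count_space UNIV)) (?R {..<T})"
      by (rule indep_var_restrict[OF indep]) auto
    have 2: "g (cd_step f i (?X \<omega>)) = g (cd_step f i (cd_iterate f (?R {..<T} \<omega>) x T))" for \<omega>
      by (subst cd_iterate_cong[of T "\<lambda>t. \<iota> t \<omega>" "?R {..<T} \<omega>"]) auto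
    have 3: "indicator {i} (\<iota> T \<omega>) = (indicator {i} (?R {T} \<omega> T) :: real)" for \<omega>
      by simp
    show ?thesis
      unfolding 2 3
      by (rule indep_var_compose[OF 1, unfolded comp_def,
            where ?Y1.0 = "\<lambda>\<kappa>. indicator {i} (\<kappa> T)"
            and ?Y2.0 = "\<lambda>\<kappa>. g (cd_step f i (cd_iterate f \<kappa> x T))"])
        (intro PiM_count_space_borel_measurable; simp)+
  qed
  have split: "g (cd_iterate f (\<lambda>t. \<iota> t \<omega>) x (Suc T)) =
      (\<Sum>i\<in>UNIV. indicator {i} (\<iota> T \<omega>) * g (cd_step f i (?X \<omega>)))" for \<omega>
    by (simp add: indicator_def of_bool_def sum.delta' if_distrib[of "\<lambda>c. c * _"] cong: if_cong)
  have "(\<integral>\<omega>. g (cd_iterate f (\<lambda>t. \<iota> t \<omega>) x (Suc T)) \<partial>M) =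
      (\<Sum>i\<in>UNIV. \<integral>\<omega>. indicator {i} (\<iota> T \<omega>) * g (cd_step f i (?X \<omega>)) \<partial>M)"
    unfolding split
    by (intro Bochner_Integration.integral_sum indep_var_integrable step integrable integrable_ind)
  also have "\<dots> = (\<Sum>i\<in>UNIV. (1 / real CARD('n)) * (\<integral>\<omega>. g (cd_step f i (?X \<omega>)) \<partial>M))"
    by (intro sum.cong refl)
      (subst indep_var_lebesgue_integral[OF step integrable_ind integrable], simp only: prob)
  also have "\<dots> = (\<Sum>i\<in>UNIV. \<integral>\<omega>. g (cd_step f i (?X \<omega>)) \<partial>M) / real CARD('n)"
    by (simp add: sum_divide_distrib)
  also have "(\<Sum>i\<in>UNIV. \<integral>\<omega>. g (cd_step f i (?X \<omega>)) \<partial>M) =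
      (\<integral>\<omega>. (\<Sum>i\<in>UNIV. g (cd_step f i (?X \<omega>))) \<partial>M)"
    by (rule Bochner_Integration.integral_sum[symmetric]) (rule integrable)
  finally show ?thesis .
qed

text \<open>Averaging over one step multiplies \<open>g\<close> by \<open>c\<close> pointwise, so
  each iteration contributes exactly one factor \<open>c\<close> to the expectation.\<close>

lemma expectation_cd_iterate_eigenfunction:
  fixes \<iota> :: "nat \<Rightarrow> 'w \<Rightarrow> 'n::finite" and g :: "real ^ 'n \<Rightarrow> real"
  assumes iid: "iid_uniform_indices M \<iota>"
    and step: "\<And>x. (\<Sum>i\<in>UNIV. g (cd_step f i x)) = real CARD('n) * c * g x"
  shows "(\<integral>\<omega>. g (cd_iterate f (\<lambda>t. \<iota> t \<omega>) x T) \<partial>M) = c ^ T * g x"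
proof (induction T)
  case 0
  interpret prob_space M
    using iid by (simp add: iid_uniform_indices_def)
  show ?case by (simp add: prob_space)
next
  case (Suc T)
  then show ?case
    by (simp only: expectation_cd_iterate_Suc[OF iid] step) simp
qed

section \<open>Action of the matrices and of a coordinate step\<close>

text \<open>\<open>position\<close> is strictly monotone, hence a bijection from the index type onto
  \<open>{1..CARD('n)}\<close>.\<close>

lemma card_position_le:
  assumes "k \<le> CARD('n)"
  shows "card {i::'n::{finite,linorder}. position i \<le> k} = k"
proof -
  have "strict_mono (position :: 'n \<Rightarrow> nat)"
    unfolding strict_mono_def position_def by (auto intro!: psubset_card_mono)
  then have inj: "inj (position :: 'n \<Rightarrow> nat)"
    by (rule strict_mono_imp_inj_on)
  have "position i \<in> {1..CARD('n)}" for i :: 'n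
    by (auto simp: position_def card_gt_0_iff Suc_le_eq intro: card_mono)
  then have "range (position :: 'n \<Rightarrow> nat) = {1..CARD('n)}"
    using inj by (intro card_subset_eq) (auto simp: card_image)
  then have "position ` {i::'n. position i \<le> k} = {1..k}"
    using assms by (fastforce simp: set_eq_iff image_iff)
  then show ?thesis
    using card_image[OF inj_on_subset[OF inj], of "{i. position i \<le> k}"] by simp
qed

text \<open>On the block, \<open>A\<close> is \<sigma> times the identity plus
  \<open>1 - \<sigma>\<close> times the rank-one matrix of the signs. So only one signed sum over
  \<open>B\<close> enters the product.\<close>

lemma A_class_mult_nth:
  fixes A :: "real ^ 'n::{finite,linorder} ^ 'n::{finite,linorder}"
  assumes "A \<in> A_class \<sigma>"
  obtains B :: "'n set" and v :: "(real, 'n) vec"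
  where "2 \<le> card B" "\<And>i. (v $ i)\<^sup>2 = 1"
    "\<And>x i. (A *v x) $ i =
      (if i \<in> B then \<sigma> * x $ i + (1 - \<sigma>) * v $ i * (\<Sum>j\<in>B. v $ j * x $ j) else x $ i)"
proof -
  obtain k v where A: "A = hadamard (PI_matrix \<sigma> k) (outer_prod v v)"
    and k: "2 \<le> k" "k \<le> CARD('n)" and "\<And>i. v $ i \<in> {-1, 1}"
    using assms by (auto simp: A_class_def PI_class_def)
  then have v: "(v $ i)\<^sup>2 = 1" for i
    by (metis insert_iff power2_minus one_power2 singletonD)
  define B where "B = {i::'n. position i \<le> k}"
  have "(A *v x) $ i =
      (if i \<in> B then \<sigma> * x $ i + (1 - \<sigma>) * v $ i * (\<Sum>j\<in>B. v $ j * x $ j) else x $ i)" for x i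
  proof (cases "i \<in> B")
    case True
    have "A $ i $ j * x $ j =
        (if j = i then \<sigma> * (v $ i)\<^sup>2 * x $ i else 0) +
        (if j \<in> B then (1 - \<sigma>) * v $ i * (v $ j * x $ j) else 0)" for j
      using True
      by (auto simp: A hadamard_def outer_prod_def PI_matrix_def B_def algebra_simps power2_eq_square)
    then show ?thesis
      using True v
      by (simp add: matrix_vector_mult_def sum.distrib sum_distrib_left flip: sum.inter_filter)
  next
    case False
    have "A $ i $ j * x $ j = (if j = i then (v $ i)\<^sup>2 * x $ i else 0)" for j
      using False by (auto simp: A hadamard_def outer_prod_def PI_matrix_def B_def power2_eq_square)
    then show ?thesis
      using False v by (simp add: matrix_vector_mult_def)
  qed
  moreover have "2 \<le> card B"
    using k by (simp add: B_def card_position_le)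
  ultimately show ?thesis
    using that v by blast
qed

lemma cd_step_quadratic_set_coord:
  fixes A :: "real ^ 'n ^ 'n"
  assumes "transpose A = A" "A $ i $ i = 1"
  shows "cd_step (quadratic A) i x = set_coord x i (x $ i - (A *v x) $ i)"
proof -
  have "arg_min (\<lambda>s. quadratic A (set_coord x i s)) (\<lambda>_. True) = x $ i - (A *v x) $ i"
    unfolding quadratic_set_coord[OF assms] arg_min_def is_arg_min_linorder
    by (rule some_equality) (simp, force dest: spec[of _ "x $ i - (A *v x) $ i"])
  then show ?thesis
    by (simp add: cd_step_def)
qed

text \<open>Only the summand at \<open>i\<close> changes. A general \<open>h\<close> covers both the
  sums of squares and the signed sum.\<close>

lemma sum_set_coord:
  assumes "finite B"
  shows "(\<Sum>j\<in>B. h j (set_coord x i s $ j)) =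
    (\<Sum>j\<in>B. h j (x $ j)) + (if i \<in> B then h i s - h i (x $ i) else (0::real))"
proof -
  have "(\<Sum>j\<in>B. h j (set_coord x i s $ j)) =
      (\<Sum>j\<in>B. h j (x $ j) + (if j = i then h i s - h i (x $ i) else 0))"
    by (rule sum.cong) (auto simp: set_coord_def)
  then show ?thesis
    using assms by (simp add: sum.distrib)
qed

text \<open>The row \<open>(1, u)\<close> is a left eigenvector of the matrix with rows
  \<open>(a, b)\<close> and \<open>(c, d)\<close>, with eigenvalue \<open>a + u * c\<close>. The
  witness is the larger root of \<open>c * u\<^sup>2 + (a - d) * u - b = 0\<close>, nonnegative
  since the product of the roots is \<open>- b / c \<le> 0\<close>.\<close>

lemma nonneg_left_eigenvector:
  fixes a b c d :: real
  assumes "0 \<le> b" "0 < c"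
  obtains u where "0 \<le> u" "b + u * d = (a + u * c) * u"
proof
  define r where "r = sqrt ((a - d)\<^sup>2 + 4 * b * c)"
  have "(a - d)\<^sup>2 \<le> (a - d)\<^sup>2 + 4 * b * c"
    using assms by simp
  then have "\<bar>a - d\<bar> \<le> r"
    unfolding r_def by (metis real_sqrt_abs real_sqrt_le_mono)
  then show "0 \<le> (r - (a - d)) / (2 * c)"
    using assms by simp
  have r: "r * r = (a - d) * (a - d) + 4 * b * c"
    using assms by (simp add: r_def power2_eq_square)
  show "b + (r - (a - d)) / (2 * c) * d =
      (a + (r - (a - d)) / (2 * c) * c) * ((r - (a - d)) / (2 * c))"
    using assms r by (simp add: field_simps) algebra
qed

theorem theorem3p4:
  fixes A :: "real ^ 'n::{finite,linorder} ^ 'n::{finite,linorder}"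
    and \<sigma> :: real
    and M :: "'w measure"
    and \<iota> :: "nat \<Rightarrow> 'w \<Rightarrow> 'n"
  assumes "CARD('n) \<ge> 2"
    and "0 < \<sigma>" and "\<sigma> \<le> 1"
    and "A \<in> A_class \<sigma>"
    and "iid_uniform_indices M \<iota>"
  shows "AE x\<^sub>0 in lebesgue. \<exists>L.
    (\<lambda>T. ((\<integral>\<omega>. (norm (cd_iterate (quadratic A) (\<lambda>t. \<iota> t \<omega>) x\<^sub>0 T))\<^sup>2 \<partial>M) / (norm x\<^sub>0)\<^sup>2)
           powr (1 / real T)) \<longlonglongrightarrow> L \<and>
    L \<ge> 1 - 1 / real CARD('n) + (1 - \<sigma>)\<^sup>2 / real CARD('n)"
proof -
  obtain B :: "'n set" and v :: "(real, 'n) vec" where B: "2 \<le> card B" and v: "\<And>i. (v $ i)\<^sup>2 = 1"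
    and mult: "\<And>x i. (A *v x) $ i =
      (if i \<in> B then \<sigma> * x $ i + (1 - \<sigma>) * v $ i * (\<Sum>j\<in>B. v $ j * x $ j) else x $ i)"
    by (rule A_class_mult_nth[OF assms(4)]) blast
  define n k where "n = real CARD('n)" and "k = real (card B)"
  have n: "2 \<le> n" and k: "2 \<le> k"
    using assms(1) B by (simp_all add: n_def k_def)
  define p q S :: "(real, 'n) vec \<Rightarrow> real" where "p x = (\<Sum>j\<in>B. (x $ j)\<^sup>2)"
    and "q x = (\<Sum>j\<in>-B. (x $ j)\<^sup>2)" and "S x = (\<Sum>j\<in>B. v $ j * x $ j)" for x
  let ?f = "quadratic A"
  have step: "cd_step ?f i x = set_coord x i (if i \<in> B then (1 - \<sigma>) * (x $ i - v $ i * S x) else 0)"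
    for i x
    using cd_step_quadratic_set_coord[OF A_class_symmetric A_class_unit_diagonal, OF assms(4) assms(4)]
    by (simp add: mult S_def algebra_simps)
  have p_set: "p (set_coord x i s) = p x + (if i \<in> B then s\<^sup>2 - (x $ i)\<^sup>2 else 0)"
    and q_set: "q (set_coord x i s) = q x + (if i \<in> -B then s\<^sup>2 - (x $ i)\<^sup>2 else 0)"
    and S_set: "S (set_coord x i s) = S x + (if i \<in> B then v $ i * s - v $ i * x $ i else 0)"
    for x i s
    unfolding p_def q_def S_def
    using sum_set_coord[of B "\<lambda>_ y. y\<^sup>2"] sum_set_coord[of "-B" "\<lambda>_ y. y\<^sup>2"]
      sum_set_coord[of B "\<lambda>j y. v $ j * y"]
    by simp_all
  have UNIV_split: "(\<Sum>i\<in>UNIV. h i) = (\<Sum>i\<in>B. h i) + (\<Sum>i\<in>-B. h i)" for h :: "'n \<Rightarrow> real"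
    using sum.union_disjoint[of B "-B" h] by simp
  have card_compl: "real (card (-B)) = n - k"
    using card_mono[of UNIV B] by (simp add: n_def k_def Compl_eq_Diff_UNIV card_Diff_subset of_nat_diff)

  \<comment> \<open>Linear action of the averaged step on \<open>p\<close>, \<open>S\<^sup>2\<close>
    and \<open>q\<close>\<close>
  \<comment> \<open>The averaged step maps \<open>p\<close> to \<open>a * p + b * S\<^sup>2\<close>
    and \<open>S\<^sup>2\<close> to \<open>c * p + d * S\<^sup>2\<close>; \<open>a\<close> is
    exactly the claimed bound. In \<open>k - 2\<close>, the \<open>k\<close> counts the steps inside
    \<open>B\<close> and the \<open>-2\<close> comes from the cross terms, which sum to a multiple
    of \<open>S * S\<close>.\<close>
  define a b c d where "a = 1 - 1 / n + (1 - \<sigma>)\<^sup>2 / n" and "b = (1 - \<sigma>)\<^sup>2 * (k - 2) / n"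
    and "c = \<sigma>\<^sup>2 / n" and "d = 1 - k / n + \<sigma>\<^sup>2 * (k - 2) / n"
  have n_mult: "n * a = n - 1 + (1 - \<sigma>)\<^sup>2" "n * b = (1 - \<sigma>)\<^sup>2 * (k - 2)"
    "n * c = \<sigma>\<^sup>2" "n * d = n - k + \<sigma>\<^sup>2 * (k - 2)"
    using n by (simp_all add: a_def b_def c_def d_def field_simps)
  have sum_p: "(\<Sum>i\<in>UNIV. p (cd_step ?f i x)) = n * (a * p x + b * (S x)\<^sup>2)" for x
  proof -
    have "p (cd_step ?f i x) =
        p x + ((1 - \<sigma>)\<^sup>2 - 1) * (x $ i)\<^sup>2 - 2 * (1 - \<sigma>)\<^sup>2 * S x * (v $ i * x $ i) + (1 - \<sigma>)\<^sup>2 * (S x)\<^sup>2"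
      if "i \<in> B" for i
      using that v[of i] unfolding step p_set by (simp add: power2_eq_square) algebra
    then have "(\<Sum>i\<in>B. p (cd_step ?f i x)) =
        k * p x + ((1 - \<sigma>)\<^sup>2 - 1) * p x - 2 * (1 - \<sigma>)\<^sup>2 * S x * S x + k * (1 - \<sigma>)\<^sup>2 * (S x)\<^sup>2"
      by (simp add: sum.distrib sum_subtractf k_def p_def[of x] S_def[of x] flip: sum_distrib_left)
    moreover have "(\<Sum>i\<in>-B. p (cd_step ?f i x)) = (n - k) * p x"
      by (simp add: step p_set card_compl)
    ultimately show ?thesis
      by (simp add: UNIV_split distrib_left n_mult flip: mult.assoc)
        (simp add: algebra_simps power2_eq_square)
  qed
  have sum_S: "(\<Sum>i\<in>UNIV. (S (cd_step ?f i x))\<^sup>2) = n * (c * p x + d * (S x)\<^sup>2)" for x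
  proof -
    have "(S (cd_step ?f i x))\<^sup>2 =
        \<sigma>\<^sup>2 * (S x)\<^sup>2 - 2 * \<sigma>\<^sup>2 * S x * (v $ i * x $ i) + \<sigma>\<^sup>2 * (x $ i)\<^sup>2"
      if "i \<in> B" for i
    proof -
      \<comment> \<open>The step makes \<open>v $ i\<close> times the new coordinate equal to
        \<open>\<sigma> - 1\<close> times the signed sum of the others, leaving \<sigma> times that
        sum.\<close>
      have "S (cd_step ?f i x) = \<sigma> * (S x - v $ i * x $ i)"
        using that v[of i] unfolding step S_set by (simp add: power2_eq_square) algebra
      then show ?thesis
        using v[of i] by (simp add: power2_eq_square) algebra
    qed
    then have "(\<Sum>i\<in>B. (S (cd_step ?f i x))\<^sup>2) =
        k * \<sigma>\<^sup>2 * (S x)\<^sup>2 - 2 * \<sigma>\<^sup>2 * S x * S x + \<sigma>\<^sup>2 * p x"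
      by (simp add: sum.distrib sum_subtractf k_def p_def[of x] S_def[of x] flip: sum_distrib_left)
    moreover have "(\<Sum>i\<in>-B. (S (cd_step ?f i x))\<^sup>2) = (n - k) * (S x)\<^sup>2"
      by (simp add: step S_set card_compl)
    ultimately show ?thesis
      by (simp add: UNIV_split distrib_left n_mult flip: mult.assoc)
        (simp add: algebra_simps power2_eq_square)
  qed
  have sum_q: "(\<Sum>i\<in>UNIV. q (cd_step ?f i x)) = n * (1 - 1 / n) * q x" for x
  proof -
    have "(\<Sum>i\<in>B. q (cd_step ?f i x)) = k * q x"
      by (simp add: step q_set k_def)
    moreover have "(\<Sum>i\<in>-B. q (cd_step ?f i x)) = (n - k) * q x - q x"
      by (simp add: step q_set sum_subtractf card_compl q_def[of x])
    moreover have "n * (1 - 1 / n) = n - 1"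
      using n by (simp add: field_simps)
    ultimately show ?thesis
      by (simp only: UNIV_split) (simp add: algebra_simps)
  qed

  \<comment> \<open>The eigenfunction \<open>V\<close> and its comparison with the norm\<close>
  have "0 \<le> b" "0 < c"
    using k n assms(2) by (simp_all add: b_def c_def)
  then obtain u where u: "0 \<le> u" and eigen: "b + u * d = (a + u * c) * u"
    by (rule nonneg_left_eigenvector)
  define \<rho> where "\<rho> = a + u * c"
  have a_le: "a \<le> \<rho>"
    using u \<open>0 < c\<close> by (simp add: \<rho>_def)
  \<comment> \<open>Thus \<open>q\<close>, which decays at rate \<open>1 - 1 / n\<close>, cannot
    dominate the rate \<rho> in the upper bound.\<close>
  have "0 < 1 - 1 / n" "1 - 1 / n \<le> a"
    using n by (simp_all add: a_def)
  then have \<rho>_pos: "0 < \<rho>" and q_rate: "0 \<le> 1 - 1 / n" "1 - 1 / n \<le> \<rho>"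
    using a_le by linarith+
  define V where "V x = p x + u * (S x)\<^sup>2" for x
  have sum_V: "(\<Sum>i\<in>UNIV. V (cd_step ?f i x)) = n * \<rho> * V x" for x
  proof -
    have "(\<Sum>i\<in>UNIV. V (cd_step ?f i x)) = n * (\<rho> * p x + (b + u * d) * (S x)\<^sup>2)"
      by (simp add: V_def sum.distrib sum_p sum_S \<rho>_def algebra_simps flip: sum_distrib_left)
    then show ?thesis
      unfolding eigen by (simp add: V_def \<rho>_def algebra_simps)
  qed
  have E_V: "(\<integral>\<omega>. V (cd_iterate ?f (\<lambda>t. \<iota> t \<omega>) x T) \<partial>M) = \<rho> ^ T * V x" for x T
    by (rule expectation_cd_iterate_eigenfunction[OF assms(5)]) (simp add: sum_V n_def)
  have E_q: "(\<integral>\<omega>. q (cd_iterate ?f (\<lambda>t. \<iota> t \<omega>) x T) \<partial>M) = (1 - 1 / n) ^ T * q x" for x T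
    by (rule expectation_cd_iterate_eigenfunction[OF assms(5)]) (simp add: sum_q n_def)
  have norm: "(norm x)\<^sup>2 = p x + q x" for x
    by (simp add: norm_vec_def L2_set_def sum_nonneg UNIV_split p_def q_def)
  have q_nonneg: "0 \<le> q x" for x
    by (simp add: q_def sum_nonneg)
  \<comment> \<open>Cauchy-Schwarz, where the squared signs over \<open>B\<close> sum to
    \<open>k\<close>.\<close>
  have "(S x)\<^sup>2 \<le> k * p x" for x
    using Cauchy_Schwarz_ineq_sum[of "($) v" "($) x" B] v
    by (simp add: S_def p_def k_def)
  then have V_le: "V x \<le> (1 + u * k) * (norm x)\<^sup>2" for x
  proof -
    have "u * (S x)\<^sup>2 \<le> u * (k * p x)" "0 \<le> u * k * q x"
      using \<open>(S x)\<^sup>2 \<le> k * p x\<close> u k q_nonneg by (auto intro: mult_left_mono)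
    then show ?thesis
      using q_nonneg[of x] by (simp add: V_def norm algebra_simps)
  qed
  have le_V: "(norm x)\<^sup>2 \<le> V x + q x" for x
    using u by (simp add: V_def norm)

  \<comment> \<open>Two-sided bounds and the exceptional null set\<close>
  obtain i\<^sub>0 where "i\<^sub>0 \<in> B"
    using B by (cases "B = {}") auto
  \<comment> \<open>One nonzero coordinate in \<open>B\<close> already forces
    \<open>V x > 0\<close>, so the exceptional points lie in a single coordinate hyperplane. The
    limit is \<rho> for every other starting point.\<close>
  have "\<exists>L. (\<lambda>T. ((\<integral>\<omega>. (norm (cd_iterate ?f (\<lambda>t. \<iota> t \<omega>) x T))\<^sup>2 \<partial>M) / (norm x)\<^sup>2)
           powr (1 / real T)) \<longlonglongrightarrow> L \<and> L \<ge> a"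
    if "x $ i\<^sub>0 \<noteq> 0" for x
  proof (intro exI conjI)
    let ?X = "\<lambda>T \<omega>. cd_iterate ?f (\<lambda>t. \<iota> t \<omega>) x T"
    note integrable = integrable_cd_iterate[OF assms(5)]
    have "(x $ i\<^sub>0)\<^sup>2 \<le> p x"
      unfolding p_def using \<open>i\<^sub>0 \<in> B\<close> by (intro member_le_sum) auto
    then have "0 < p x"
      using that by (smt (verit) zero_less_power2)
    then have V_pos: "0 < V x"
      using u by (simp add: V_def add_pos_nonneg)
    have norm_pos: "0 < (norm x)\<^sup>2"
      using \<open>0 < p x\<close> q_nonneg[of x] by (simp add: norm)
    have uk: "0 < 1 + u * k"
      using u k by (simp add: add_pos_nonneg)
    show "(\<lambda>T. ((\<integral>\<omega>. (norm (?X T \<omega>))\<^sup>2 \<partial>M) / (norm x)\<^sup>2) powr (1 / real T)) \<longlonglongrightarrow> \<rho>"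
    proof (rule powr_inverse_tendsto_of_geometric_bounds)
      show "0 < V x / (1 + u * k) / (norm x)\<^sup>2"
        using V_pos uk norm_pos by simp
      fix T
      have "\<rho> ^ T * V x \<le> (\<integral>\<omega>. (1 + u * k) * (norm (?X T \<omega>))\<^sup>2 \<partial>M)"
        unfolding E_V[symmetric]
        by (intro integral_mono integrable[where g = V]
            integrable[where g = "\<lambda>y. (1 + u * k) * (norm y)\<^sup>2"] V_le)
      then have "\<rho> ^ T * V x \<le> (1 + u * k) * (\<integral>\<omega>. (norm (?X T \<omega>))\<^sup>2 \<partial>M)"
        by (simp only: integral_mult_right_zero)
      then have "V x / (1 + u * k) * \<rho> ^ T \<le> (\<integral>\<omega>. (norm (?X T \<omega>))\<^sup>2 \<partial>M)"
        using uk by (simp add: field_simps)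
      from divide_right_mono[OF this, of "(norm x)\<^sup>2"]
      show "V x / (1 + u * k) / (norm x)\<^sup>2 * \<rho> ^ T \<le> (\<integral>\<omega>. (norm (?X T \<omega>))\<^sup>2 \<partial>M) / (norm x)\<^sup>2"
        by simp
      \<comment> \<open>\<open>V\<close> ignores the coordinates outside \<open>B\<close>, so the
        upper bound has to add \<open>q\<close>.\<close>
      have "(\<integral>\<omega>. (norm (?X T \<omega>))\<^sup>2 \<partial>M) \<le> (\<integral>\<omega>. V (?X T \<omega>) + q (?X T \<omega>) \<partial>M)"
        by (intro integral_mono integrable[where g = "\<lambda>y. (norm y)\<^sup>2"]
            integrable[where g = "\<lambda>y. V y + q y"] le_V)
      also have "\<dots> = \<rho> ^ T * V x + (1 - 1 / n) ^ T * q x"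
        using integrable[where g = V] integrable[where g = q] by (simp add: E_V E_q)
      also have "\<dots> \<le> \<rho> ^ T * V x + \<rho> ^ T * q x"
        using q_rate q_nonneg by (intro add_left_mono mult_right_mono power_mono) auto
      finally have "(\<integral>\<omega>. (norm (?X T \<omega>))\<^sup>2 \<partial>M) \<le> (V x + q x) * \<rho> ^ T"
        by (simp add: algebra_simps)
      from divide_right_mono[OF this, of "(norm x)\<^sup>2"]
      show "(\<integral>\<omega>. (norm (?X T \<omega>))\<^sup>2 \<partial>M) / (norm x)\<^sup>2 \<le> (V x + q x) / (norm x)\<^sup>2 * \<rho> ^ T"
        by simp
    qed (rule \<rho>_pos)
    show "a \<le> \<rho>"
      by (rule a_le)
  qed
  moreover have "AE x :: (real, 'n) vec in lebesgue. x $ i\<^sub>0 \<noteq> 0"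
  proof -
    have "negligible {x :: (real, 'n) vec. x $ i\<^sub>0 = 0}"
      by (rule negligible_standard_hyperplane_cart)
    then have "{x :: (real, 'n) vec. x $ i\<^sub>0 = 0} \<in> null_sets lebesgue"
      by (simp add: negligible_iff_null_sets)
    then show ?thesis
      by (rule AE_I') auto
  qed
  ultimately show ?thesis
    unfolding a_def n_def by (auto elim!: eventually_mono)
qed

end
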